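(* Let $\mathcal M=\{k_1<\cdots<k_{M_n}\}$ be a nested candidate model set. For $\mathbf w\in\mathbb R^{M_n}$ put $\gamma_m=\sum_{j=m}^{M_n}w_j$, $m=1,\ldots,M_n$, and $\boldsymbol\gamma=(\gamma_1,\ldots,\gamma_{M_n})^\top$. Then $$\hat{\boldsymbol\mu}_{\mathbf w|\mathcal M}=\sum_{m=1}^{M_n}\gamma_m\mathbf y_{m|\mathcal M},$$ $$R_n(\mathbf w|\mathcal M,\boldsymbol\mu)=R_n(\boldsymbol\gamma|\mathcal M,\boldsymbol\mu):=\sum_{m=1}^{M_n}\left[\|\boldsymbol\mu_{m|\mathcal M}\|^2(1-\gamma_m)^2+\sigma^2_{m|\mathcal M}\gamma_m^2\right]+\|\boldsymbol\mu_{M_n+1|\mathcal M}\|^2,$$ and $\mathbf w\in\mathcal W_{M_n}$ if and only if $\boldsymbol\gamma\in\Gamma_{M_n}=\{\boldsymbol\gamma:1=\gamma_1\ge\gamma_2\ge\cdots\ge\gamma_{M_n}\ge0\}$. Consequently, the optimal weight vector $\mathbf w^*=\arg\min_{\mathbf w\in\mathcal W_{M_n}}R_n(\mathbf w|\mathcal M,\boldsymbol\mu)$ and the monotone oracle $\boldsymbol\gamma^*=\arg\min_{\boldsymbol\gamma\in\Gamma_{M_n}}R_n(\boldsymbol\gamma|\mathcal M,\boldsymbol\mu)$ are related by $w_m^*=\gamma_m^*-\gamma_{m+1}^*$ for $m=1,\ldots,M_n$, with $\gamma^*_{M_n+1}=0$.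
   Context: Setting. $\mathbf y=\boldsymbol\mu+\boldsymbol\varepsilon=\mathbf X\boldsymbol\beta+\boldsymbol\varepsilon\in\mathbb R^n$, where $\mathbf X=[\mathbf x_1,\ldots,\mathbf x_{p_n}]$ is a non-random $n\times p_n$ matrix of full column rank, $p_n\le n$, and $\boldsymbol\varepsilon$ has i.i.d. $N(0,\sigma^2)$ entries with $\sigma^2>0$ known. Candidate models. $\mathcal M=\{k_1<k_2<\cdots<k_{M_n}\}$ is a set of integers in $\{1,\ldots,p_n\}$, with $k_0=0$. $\mathbf P_k$ is the orthogonal projection onto the span of $\mathbf x_1,\ldots,\mathbf x_k$, and $\mathbf P_0=\mathbf 0$. The least-squares estimators are $\hat{\boldsymbol\mu}_{k_m}=\mathbf P_{k_m}\mathbf y$. Block notation. $\mathbf D_{m|\mathcal M}=\mathbf P_{k_m}-\mathbf P_{k_{m-1}}$ for $1\le m\le M_n$ and $\mathbf D_{M_n+1|\mathcal M}=\mathbf I-\mathbf P_{k_{M_n}}$; $\mathbf y_{m|\mathcal M}=\mathbf D_{m|\mathcal M}\mathbf y$, $\boldsymbol\mu_{m|\mathcal M}=\mathbf D_{m|\mathcal M}\boldsymbol\mu$; $\sigma^2_{m|\mathcal M}=(k_m-k_{m-1})\sigma^2$; $\|\cdot\|$ is the Euclidean norm. Averaging and risk. $\hat{\boldsymbol\mu}_{\mathbf w|\mathcal M}=\sum_{m=1}^{M_n}w_m\hat{\boldsymbol\mu}_{k_m}$, $R_n(\mathbf w|\mathcal M,\boldsymbol\mu)=\mathbb E\|\hat{\boldsymbol\mu}_{\mathbf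 w|\mathcal M}-\boldsymbol\mu\|^2$, and $\mathcal W_{M_n}=\{\mathbf w\in[0,1]^{M_n}:\sum_{m=1}^{M_n}w_m=1\}$. *)

theory Defs
  imports "HOL-Probability.Probability"
begin

text \<open>
  The design matrix is given by its columns \<open>x 1, \<dots>, x p\<close> as a function
  \<open>x :: nat \<Rightarrow> real ^ 'n\<close>; the ambient dimension \<open>n\<close> is \<open>CARD('n)\<close>.
\<close>

definition full_column_rank :: "(nat \<Rightarrow> real ^ 'n) \<Rightarrow> nat \<Rightarrow> bool" where
  "full_column_rank x p \<longleftrightarrow> dim (x ` {1..p}) = p"

definition orth_proj :: "(real ^ 'n) set \<Rightarrow> real ^ 'n \<Rightarrow> real ^ 'n" where
  "orth_proj S v = (THE u. u \<in> S \<and> (\<forall>s\<in>S. orthogonal (v - u) s))"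

text \<open>For \<open>k = 0\<close> the span is \<open>{0}\<close>, so this is the zero map.\<close>

definition proj :: "(nat \<Rightarrow> real ^ 'n) \<Rightarrow> nat \<Rightarrow> real ^ 'n \<Rightarrow> real ^ 'n" where
  "proj x k = orth_proj (span (x ` {1..k}))"

text \<open>
  A model set is a finite set \<open>K\<close> of naturals; \<open>size_of K m\<close> is its \<open>m\<close>-th smallest
  element, counted from 1, with the convention \<open>size_of K 0 = 0\<close>.
\<close>

definition size_of :: "nat set \<Rightarrow> nat \<Rightarrow> nat" where
  "size_of K m = (if m = 0 then 0 else sorted_list_of_set K ! (m - 1))"

text \<open>The operator \<open>D\<^sub>m\<close>, for \<open>1 \<le> m \<le> card K + 1\<close>.\<close>

definition block :: "(nat \<Rightarrow> real ^ 'n) \<Rightarrow> nat set \<Rightarrow> nat \<Rightarrow> real ^ 'n \<Rightarrow> real ^ 'n" where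
  "block x K m v =
     (if m \<le> card K then proj x (size_of K m) v - proj x (size_of K (m - 1)) v
      else v - proj x (size_of K (card K)) v)"

definition block_var :: "real \<Rightarrow> nat set \<Rightarrow> nat \<Rightarrow> real" where
  "block_var \<sigma> K m = (real (size_of K m) - real (size_of K (m - 1))) * \<sigma>\<^sup>2"

definition averaged :: "(nat \<Rightarrow> real ^ 'n) \<Rightarrow> nat set \<Rightarrow> (nat \<Rightarrow> real) \<Rightarrow> real ^ 'n \<Rightarrow> real ^ 'n" where
  "averaged x K w y = (\<Sum>m=1..card K. w m *\<^sub>R proj x (size_of K m) y)"

definition risk ::
  "'w measure \<Rightarrow> ('w \<Rightarrow> real ^ 'n) \<Rightarrow> (nat \<Rightarrow> real ^ 'n) \<Rightarrow> nat set \<Rightarrow> real ^ 'n \<Rightarrow> (nat \<Rightarrow> real) \<Rightarrow> real"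
  where
  "risk \<Omega> y x K \<mu> w = (\<integral>\<omega>. (norm (averaged x K w (y \<omega>) - \<mu>))\<^sup>2 \<partial>\<Omega>)"

definition risk_cumulative ::
  "real \<Rightarrow> (nat \<Rightarrow> real ^ 'n) \<Rightarrow> nat set \<Rightarrow> real ^ 'n \<Rightarrow> (nat \<Rightarrow> real) \<Rightarrow> real" where
  "risk_cumulative \<sigma> x K \<mu> \<gamma> =
     (\<Sum>m=1..card K. (norm (block x K m \<mu>))\<^sup>2 * (1 - \<gamma> m)\<^sup>2 + block_var \<sigma> K m * (\<gamma> m)\<^sup>2)
     + (norm (block x K (card K + 1) \<mu>))\<^sup>2"

text \<open>
  Vectors of length \<open>M\<close> with entries indexed from 1 are extensional functions on \<open>{1..M}\<close>,
  so that equality of vectors is equality of functions.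
\<close>

definition vectors :: "nat \<Rightarrow> (nat \<Rightarrow> real) set" where
  "vectors M = ({1..M} \<rightarrow>\<^sub>E UNIV)"

definition cumulative :: "nat \<Rightarrow> (nat \<Rightarrow> real) \<Rightarrow> nat \<Rightarrow> real" where
  "cumulative M w = (\<lambda>m\<in>{1..M}. \<Sum>j=m..M. w j)"

definition weight_simplex :: "nat \<Rightarrow> (nat \<Rightarrow> real) set" where
  "weight_simplex M = {w \<in> {1..M} \<rightarrow>\<^sub>E {0..1}. (\<Sum>m=1..M. w m) = 1}"

definition monotone_vectors :: "nat \<Rightarrow> (nat \<Rightarrow> real) set" where
  "monotone_vectors M =
     {\<gamma> \<in> vectors M. \<gamma> 1 = 1 \<and> (\<forall>m\<in>{1..<M}. \<gamma> (Suc m) \<le> \<gamma> m) \<and> 0 \<le> \<gamma> M}"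

end

theory Submission
  imports Defs
begin

text \<open>
  Summation by parts rewrites the averaged estimator in terms of increments of nested orthogonal
  projections. These increments are mutually orthogonal, so by Pythagoras the loss splits into one
  quadratic term per block, and the mean squared length of isotropic noise in a block is its
  variance times the dimension of the block. In the variables \<open>\<gamma>\<close> the risk is a
  separable quadratic with positive leading coefficients on a compact convex set: minimisers exist
  by compactness, and two of them coincide by comparison with their midpoint. The linear bijection
  between \<open>w\<close> and \<open>\<gamma>\<close> carries minimisers to minimisers.
\<close>

section \<open>Orthogonal projections\<close>

text \<open>Two such vectors differ by an element of \<open>S\<close> that is orthogonal to itself,
  hence zero. This settles the uniqueness behind \<open>THE\<close>, so later projections are
  identified by checking membership and residual.\<close>

lemma orth_proj_eqI:
  assumes "subspace S" "u \<in> S" "\<And>s. s \<in> S \<Longrightarrow> orthogonal (v - u) s"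
  shows "orth_proj S v = u"
  unfolding orth_proj_def
proof (rule the_equality)
  fix u' assume u': "u' \<in> S \<and> (\<forall>s\<in>S. orthogonal (v - u') s)"
  have d: "u - u' \<in> S"
    using assms(1,2) u' by (simp add: subspace_diff)
  have "(u - u') \<bullet> (u - u') = (v - u') \<bullet> (u - u') - (v - u) \<bullet> (u - u')"
    by (simp add: inner_diff_left)
  also have "\<dots> = 0"
    using assms(3)[OF d] u' d by (simp add: orthogonal_def)
  finally show "u' = u"
    by simp
qed (use assms in auto)

context
  fixes S :: "(real ^ 'n) set"
  assumes S: "subspace S"
begin

lemma orth_proj_mem: "orth_proj S v \<in> S"
  and orth_proj_residual: "s \<in> S \<Longrightarrow> orthogonal (v - orth_proj S v) s"
proof -
  obtain y z where yz: "y \<in> span S" "\<And>w. w \<in> span S \<Longrightarrow> orthogonal z w" "v = y + z"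
    using orthogonal_subspace_decomp_exists[of S v] by blast
  have "span S = S"
    using S by simp
  have "orth_proj S v = y" "\<And>s. s \<in> S \<Longrightarrow> orthogonal (v - y) s" "y \<in> S"
    using S yz by (auto simp: \<open>span S = S\<close> intro!: orth_proj_eqI)
  then show "orth_proj S v \<in> S" "s \<in> S \<Longrightarrow> orthogonal (v - orth_proj S v) s"
    by auto
qed

lemma linear_orth_proj: "linear (orth_proj S)"
proof (rule linearI)
  show "orth_proj S (u + v) = orth_proj S u + orth_proj S v" for u v
  proof (rule orth_proj_eqI[OF S])
    fix s assume "s \<in> S"
    then show "orthogonal (u + v - (orth_proj S u + orth_proj S v)) s"
      using orth_proj_residual[of s u] orth_proj_residual[of s v]
      by (simp add: orthogonal_def inner_diff_left inner_add_left)
  qed (simp add: S orth_proj_mem subspace_add)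
  show "orth_proj S (c *\<^sub>R v) = c *\<^sub>R orth_proj S v" for c v
  proof (rule orth_proj_eqI[OF S])
    fix s assume "s \<in> S"
    then show "orthogonal (c *\<^sub>R v - c *\<^sub>R orth_proj S v) s"
      using orth_proj_residual[of s v]
      by (simp add: orthogonal_def inner_diff_left)
  qed (simp add: S orth_proj_mem subspace_mul)
qed

lemma inner_orth_proj_right:
  assumes "u \<in> S"
  shows "u \<bullet> orth_proj S v = u \<bullet> v"
  using orth_proj_residual[OF assms, of v]
  by (simp add: orthogonal_def inner_diff_left inner_diff_right inner_commute)

text \<open>Parseval in an orthonormal basis of \<open>S\<close>: as \<open>b\<close> lies in
  \<open>S\<close>, the coefficient of the projection along \<open>b\<close> is that of
  \<open>v\<close> itself. One basis serves every \<open>v\<close>, so a random vector can be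
  inserted later.\<close>

lemma norm_orth_proj_eq_sum:
  obtains B where "finite B" "card B = dim S" "\<And>b. b \<in> B \<Longrightarrow> norm b = 1"
    "\<And>v. (norm (orth_proj S v))\<^sup>2 = (\<Sum>b\<in>B. (v \<bullet> b)\<^sup>2)"
proof -
  obtain B where B: "B \<subseteq> S" "pairwise orthogonal B" "\<And>b. b \<in> B \<Longrightarrow> norm b = 1"
      "independent B" "card B = dim S" "span B = S"
    using orthonormal_basis_subspace[OF S] by metis
  have fin: "finite B"
    using B(4) by (rule independent_imp_finite)
  have "(norm (orth_proj S v))\<^sup>2 = (\<Sum>b\<in>B. (v \<bullet> b)\<^sup>2)" for v
  proof -
    have "orth_proj S v = (\<Sum>b\<in>B. (orth_proj S v \<bullet> b) *\<^sub>R b)"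
      using orthonormal_basis_expand[OF B(2,3) _ fin, of "orth_proj S v"] B(6) orth_proj_mem[of v]
      by simp
    also have "\<dots> = (\<Sum>b\<in>B. (v \<bullet> b) *\<^sub>R b)"
      using B(1) inner_orth_proj_right[of _ v] by (auto simp: inner_commute intro!: sum.cong)
    finally have "(norm (orth_proj S v))\<^sup>2 = (norm (\<Sum>b\<in>B. (v \<bullet> b) *\<^sub>R b))\<^sup>2"
      by simp
    also have "\<dots> = (\<Sum>b\<in>B. (norm ((v \<bullet> b) *\<^sub>R b))\<^sup>2)"
      using B(2) fin by (intro norm_sum_Pythagorean) (auto simp: pairwise_def orthogonal_def)
    also have "\<dots> = (\<Sum>b\<in>B. (v \<bullet> b)\<^sup>2)"
      using B(3) by simp
    finally show ?thesis .
  qed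
  with fin B(3,5) show ?thesis
    using that by blast
qed

end

lemma inner_orth_proj_nested:
  assumes "subspace S" "subspace T" "S \<subseteq> T"
  shows "orth_proj S u \<bullet> orth_proj T v = orth_proj S u \<bullet> v"
    and "orth_proj T v \<bullet> orth_proj S u = orth_proj S u \<bullet> v"
  using inner_orth_proj_right[OF assms(2), of "orth_proj S u" v] orth_proj_mem[OF assms(1)] assms(3)
  by (auto simp: inner_commute)

text \<open>By nestedness the cross term collapses to the squared norm of the smaller projection.
  This later turns the variance of a block into a difference of two dimensions.\<close>

lemma norm_orth_proj_diff:
  assumes "subspace S" "subspace T" "S \<subseteq> T"
  shows "(norm (orth_proj T v - orth_proj S v))\<^sup>2 = (norm (orth_proj T v))\<^sup>2 - (norm (orth_proj S v))\<^sup>2"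
  using inner_orth_proj_nested[OF assms, of v v] inner_orth_proj_nested[OF assms(1,1) order_refl, of v v]
  by (simp add: power2_norm_eq_inner inner_diff_left inner_diff_right)

lemma orth_proj_UNIV [simp]: "orth_proj UNIV v = v"
  by (rule orth_proj_eqI) (auto simp: orthogonal_def)

lemma orth_proj_singleton_0 [simp]: "orth_proj {0} v = 0"
  by (rule orth_proj_eqI) (auto simp: orthogonal_def)


section \<open>Blocks of a nested model set\<close>

text \<open>Taking the whole space at index \<open>card K + 1\<close> makes the residual block an increment of
  projections like the other blocks.\<close>

definition model_space :: "(nat \<Rightarrow> real ^ 'n) \<Rightarrow> nat set \<Rightarrow> nat \<Rightarrow> (real ^ 'n) set" where
  "model_space x K m = (if m \<le> card K then span (x ` {1..size_of K m}) else UNIV)"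

lemma subspace_model_space: "subspace (model_space x K m)"
  by (simp add: model_space_def)

lemma proj_eq_orth_proj: "m \<le> card K \<Longrightarrow> proj x (size_of K m) = orth_proj (model_space x K m)"
  by (simp add: proj_def model_space_def)

lemma proj_size_of_0 [simp]: "proj x (size_of K 0) v = 0"
  by (simp add: proj_def size_of_def)

lemma block_eq_orth_proj:
  assumes "1 \<le> m" "m \<le> card K + 1"
  shows "block x K m v = orth_proj (model_space x K m) v - orth_proj (model_space x K (m - 1)) v"
proof (cases "m \<le> card K")
  case True
  then show ?thesis
    by (simp add: block_def proj_eq_orth_proj)
next
  case False
  then have "m = card K + 1"
    using assms by simp
  then show ?thesis
    by (simp add: block_def proj_eq_orth_proj) (simp add: model_space_def)
qed

lemma linear_block:
  assumes "1 \<le> m" "m \<le> card K + 1"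
  shows "linear (block x K m)"
  unfolding block_eq_orth_proj[OF assms, abs_def]
  by (intro linear_compose_sub linear_orth_proj subspace_model_space)

section \<open>Sizes and dimensions of the nested models\<close>

lemma size_of_less:
  assumes "finite K" "0 \<notin> K" "i < j" "j \<le> card K"
  shows "size_of K i < size_of K j"
proof (cases "i = 0")
  case True
  \<comment> \<open>Index 0 is the convention \<open>size_of K 0 = 0\<close> and not a list entry;
    the strict inequality comes from \<open>0 \<notin> K\<close>.\<close>
  have "sorted_list_of_set K ! (j - 1) \<in> K"
    using nth_mem[of "j - 1" "sorted_list_of_set K"] assms by auto
  then have "sorted_list_of_set K ! (j - 1) \<noteq> 0"
    using assms(2) by metis
  with True assms show ?thesis
    by (simp add: size_of_def)
next
  case False
  then show ?thesis
    using assms sorted_wrt_nth_less[OF strict_sorted_list_of_set, of "i - 1" "j - 1" K]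
    by (simp add: size_of_def)
qed

lemma size_of_le:
  assumes "K \<subseteq> {1..p}" "m \<le> card K"
  shows "size_of K m \<le> p"
proof (cases "m = 0")
  case False
  have "finite K"
    using assms(1) finite_subset by auto
  then have "sorted_list_of_set K ! (m - 1) \<in> K"
    using nth_mem[of "m - 1" "sorted_list_of_set K"] assms False by auto
  then show ?thesis
    using assms False by (auto simp: size_of_def)
qed (simp add: size_of_def)

lemma model_space_mono:
  assumes "finite K" "0 \<notin> K" "i \<le> j"
  shows "model_space x K i \<subseteq> model_space x K j"
proof (cases "j \<le> card K")
  case True
  then have "size_of K i \<le> size_of K j"
    using size_of_less[OF assms(1,2)] assms(3) by (cases "i = j") (auto intro: less_imp_le)
  then have "x ` {1..size_of K i} \<subseteq> x ` {1..size_of K j}"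
    by auto
  then show ?thesis
    using True assms(3) by (simp add: model_space_def span_mono)
qed (simp add: model_space_def)

text \<open>Full rank forces a basis chosen among the columns to have \<open>p\<close> elements,
  hence to contain all of them. So the columns are independent and pairwise distinct, and both
  properties pass to an initial segment.\<close>

lemma dim_model_space:
  assumes "full_column_rank x p" "K \<subseteq> {1..p}" "m \<le> card K"
  shows "dim (model_space x K m) = size_of K m"
proof -
  obtain B where B: "B \<subseteq> x ` {1..p}" "independent B" "card B = dim (x ` {1..p})"
    using basis_exists[of "x ` {1..p}"] by metis
  have cB: "card B = p"
    using B(3) assms(1) by (simp add: full_column_rank_def)
  have ci: "card (x ` {1..p}) \<le> p"
    using card_image_le[of "{1..p}" x] by simp
  have "B = x ` {1..p}"
    using B(1) cB ci by (intro card_seteq) auto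
  then have ind: "independent (x ` {1..p})" and inj: "inj_on x {1..p}"
    using B(2) cB by (auto intro: eq_card_imp_inj_on)
  have sub: "{1..size_of K m} \<subseteq> {1..p}"
    using size_of_le[OF assms(2,3)] by auto
  have "dim (x ` {1..size_of K m}) = card (x ` {1..size_of K m})"
    using independent_mono[OF ind image_mono[OF sub]] by (simp add: dim_eq_card_independent)
  also have "\<dots> = size_of K m"
    using inj_on_subset[OF inj sub] by (simp add: card_image)
  finally show ?thesis
    using assms(3) by (simp add: model_space_def)
qed

text \<open>For \<open>i < j\<close> both spaces of block \<open>i\<close> lie inside both spaces of
  block \<open>j\<close>. Each inner product with a larger projection then reduces to one with
  \<open>v\<close>, and the two terms of block \<open>j\<close> cancel.\<close>

lemma block_orthogonal:
  assumes "finite K" "0 \<notin> K" "i \<in> {1..card K + 1}" "j \<in> {1..card K + 1}" "i \<noteq> j"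
  shows "orthogonal (block x K i u) (block x K j v)"
proof -
  have "orthogonal (block x K i u) (block x K j v)"
    if "i < j" "i \<in> {1..card K + 1}" "j \<in> {1..card K + 1}" for i j u v
  proof -
    have le: "i - 1 \<le> j - 1" "i \<le> j - 1" "i - 1 \<le> j" "i \<le> j"
      using that by auto
    note nested = inner_orth_proj_nested(1)[OF subspace_model_space subspace_model_space
        model_space_mono[OF assms(1,2)], of _ _ x]
    show ?thesis
      using that
      by (simp add: orthogonal_def block_eq_orth_proj inner_diff_left inner_diff_right nested le)
  qed
  then show ?thesis
    using assms(3-5) by (metis linorder_neqE_nat orthogonal_commute)
qed

lemma norm_sum_blocks:
  assumes "finite K" "0 \<notin> K"
  shows "(norm (\<Sum>m=1..card K + 1. block x K m (u m)))\<^sup>2 = (\<Sum>m=1..card K + 1. (norm (block x K m (u m)))\<^sup>2)"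
  by (rule norm_sum_Pythagorean) (auto simp: pairwise_def intro!: block_orthogonal[OF assms])

section \<open>Telescoping and summation by parts\<close>

lemma sum_increments:
  fixes P :: "nat \<Rightarrow> 'a::ab_group_add"
  shows "(\<Sum>m=1..M. P m - P (m - 1)) = P M - P 0"
  by (induction M) auto

lemma sum_blocks: "(\<Sum>m=1..card K + 1. block x K m v) = v"
proof -
  have "(\<Sum>m=1..card K + 1. block x K m v)
      = (\<Sum>m=1..card K + 1. orth_proj (model_space x K m) v - orth_proj (model_space x K (m - 1)) v)"
    by (intro sum.cong) (auto simp: block_eq_orth_proj)
  also have "\<dots> = v"
    by (subst sum_increments) (simp add: model_space_def size_of_def)
  finally show ?thesis .
qed

lemma sum_scaleR_by_parts:
  fixes P :: "nat \<Rightarrow> 'a::real_vector"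
  assumes "P 0 = 0"
  shows "(\<Sum>m=1..M. w m *\<^sub>R P m) = (\<Sum>m=1..M. (\<Sum>j=m..M. w j) *\<^sub>R (P m - P (m - 1)))"
proof (induction M)
  case (Suc M)
  have "(\<Sum>m=1..Suc M. (\<Sum>j=m..Suc M. w j) *\<^sub>R (P m - P (m - 1)))
      = (\<Sum>m=1..M. ((\<Sum>j=m..M. w j) + w (Suc M)) *\<^sub>R (P m - P (m - 1)))
        + w (Suc M) *\<^sub>R (P (Suc M) - P M)"
    by simp
  \<comment> \<open>The new weight enters every tail sum; the increments it multiplies telescope to
    \<open>P M - P 0\<close>, and \<open>P 0 = 0\<close> removes the boundary term.\<close>
  also have "\<dots> = (\<Sum>m=1..M. w m *\<^sub>R P m) + w (Suc M) *\<^sub>R (\<Sum>m=1..M. P m - P (m - 1))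
        + w (Suc M) *\<^sub>R (P (Suc M) - P M)"
    using Suc.IH by (simp add: scaleR_add_left sum.distrib scaleR_sum_right)
  also have "\<dots> = (\<Sum>m=1..Suc M. w m *\<^sub>R P m)"
    by (subst sum_increments) (simp add: assms algebra_simps)
  finally show ?case
    by simp
qed simp

lemma averaged_eq_sum_blocks:
  "averaged x K w v = (\<Sum>m=1..card K. cumulative (card K) w m *\<^sub>R block x K m v)"
proof -
  have "averaged x K w v = (\<Sum>m=1..card K. (\<Sum>j=m..card K. w j) *\<^sub>R
      (proj x (size_of K m) v - proj x (size_of K (m - 1)) v))"
    unfolding averaged_def by (rule sum_scaleR_by_parts) simp
  also have "\<dots> = (\<Sum>m=1..card K. cumulative (card K) w m *\<^sub>R block x K m v)"
    by (intro sum.cong) (auto simp: cumulative_def block_def)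
  finally show ?thesis .
qed


section \<open>The risk of model averaging\<close>

text \<open>The entries have mean zero and covariance \<sigma>^2 times the identity; both claims
  follow by expanding in coordinates. Stating them with \<open>has_bochner_integral\<close> carries
  integrability along with the value.\<close>

lemma (in prob_space) white_noise_inner:
  fixes \<epsilon> :: "'a \<Rightarrow> real ^ 'n"
  assumes indep: "indep_vars (\<lambda>_. borel) (\<lambda>i \<omega>. \<epsilon> \<omega> $ i) UNIV"
    and normal: "\<And>i. distributed M lborel (\<lambda>\<omega>. \<epsilon> \<omega> $ i) (normal_density 0 \<sigma>)"
    and "\<sigma> > 0"
  shows "has_bochner_integral M (\<lambda>\<omega>. \<epsilon> \<omega> \<bullet> b) 0"
    and "has_bochner_integral M (\<lambda>\<omega>. (\<epsilon> \<omega> \<bullet> b)\<^sup>2) (\<sigma>\<^sup>2 * (norm b)\<^sup>2)"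
proof -
  have int: "integrable M (\<lambda>\<omega>. \<epsilon> \<omega> $ i)" for i
    using integrable_normal_moment_nz_1[OF \<open>\<sigma> > 0\<close>, of 0]
    by (intro distributed_integrable_var[OF normal]) (auto simp: normal_density_nonneg)
  have ex: "expectation (\<lambda>\<omega>. \<epsilon> \<omega> $ i) = 0" for i
    using normal_distributed_expectation[OF \<open>\<sigma> > 0\<close> normal] .
  have int2: "integrable M (\<lambda>\<omega>. (\<epsilon> \<omega> $ i)\<^sup>2)" for i
    using integrable_normal_moment[OF \<open>\<sigma> > 0\<close>, of 0 2]
      distributed_integrable[OF normal, of "\<lambda>x. x\<^sup>2" i]
    by (simp add: normal_density_nonneg)
  have ex2: "expectation (\<lambda>\<omega>. (\<epsilon> \<omega> $ i)\<^sup>2) = \<sigma>\<^sup>2" for i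
    using normal_distributed_variance[OF \<open>\<sigma> > 0\<close> normal, of i] by (simp add: ex)
  have cov: "has_bochner_integral M (\<lambda>\<omega>. \<epsilon> \<omega> $ i * \<epsilon> \<omega> $ j) (if i = j then \<sigma>\<^sup>2 else 0)" for i j
  proof (cases "i = j")
    case True
    then show ?thesis
      using int2[of i] ex2[of i] by (simp add: has_bochner_integral_iff power2_eq_square)
  next
    case False
    \<comment> \<open>Off the diagonal, independence of the pair factors the expectation into a
      product of two zero means.\<close>
    have ind: "indep_vars (\<lambda>_. borel) (\<lambda>i \<omega>. \<epsilon> \<omega> $ i) {i, j}"
      using indep_vars_subset[OF indep] by simp
    show ?thesis
      using False int indep_vars_integrable[OF _ ind] indep_vars_lebesgue_integral[OF _ ind]
      by (simp add: has_bochner_integral_iff ex)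
  qed
  have "has_bochner_integral M (\<lambda>\<omega>. \<Sum>i\<in>UNIV. \<epsilon> \<omega> $ i * b $ i) (\<Sum>i\<in>UNIV. 0 * b $ i)"
    using int ex by (intro has_bochner_integral_sum has_bochner_integral_mult_left)
      (simp add: has_bochner_integral_iff)
  then show "has_bochner_integral M (\<lambda>\<omega>. \<epsilon> \<omega> \<bullet> b) 0"
    by (simp add: inner_vec_def)
  have "has_bochner_integral M (\<lambda>\<omega>. \<Sum>i\<in>UNIV. \<Sum>j\<in>UNIV. (\<epsilon> \<omega> $ i * \<epsilon> \<omega> $ j) * (b $ i * b $ j))
      (\<Sum>i\<in>UNIV. \<Sum>j\<in>UNIV. (if i = j then \<sigma>\<^sup>2 else 0) * (b $ i * b $ j))"
    by (intro has_bochner_integral_sum has_bochner_integral_mult_left cov)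
  moreover have "(\<Sum>i\<in>UNIV. \<Sum>j\<in>UNIV. (\<epsilon> \<omega> $ i * \<epsilon> \<omega> $ j) * (b $ i * b $ j)) = (\<epsilon> \<omega> \<bullet> b)\<^sup>2" for \<omega>
    by (simp add: inner_vec_def power2_eq_square sum_product ac_simps)
  moreover have "(\<Sum>i\<in>UNIV. \<Sum>j\<in>UNIV. (if i = j then \<sigma>\<^sup>2 else 0) * (b $ i * b $ j)) = \<sigma>\<^sup>2 * (norm b)\<^sup>2"
    by (simp add: if_distrib[of "\<lambda>c. c * _"] power2_norm_eq_inner inner_vec_def sum_distrib_left cong: if_cong)
  ultimately show "has_bochner_integral M (\<lambda>\<omega>. (\<epsilon> \<omega> \<bullet> b)\<^sup>2) (\<sigma>\<^sup>2 * (norm b)\<^sup>2)"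
    by simp
qed

text \<open>By Parseval the squared length is a sum of \<open>dim S\<close> squared coefficients
  along unit vectors, each of mean \<sigma>^2.\<close>

lemma (in prob_space) white_noise_orth_proj:
  fixes \<epsilon> :: "'a \<Rightarrow> real ^ 'n"
  assumes "\<And>b. has_bochner_integral M (\<lambda>\<omega>. (\<epsilon> \<omega> \<bullet> b)\<^sup>2) (\<sigma>\<^sup>2 * (norm b)\<^sup>2)" "subspace S"
  shows "has_bochner_integral M (\<lambda>\<omega>. (norm (orth_proj S (\<epsilon> \<omega>)))\<^sup>2) (real (dim S) * \<sigma>\<^sup>2)"
proof -
  obtain B where B: "finite B" "card B = dim S" "\<And>b. b \<in> B \<Longrightarrow> norm b = 1"
    and n: "\<And>v. (norm (orth_proj S v))\<^sup>2 = (\<Sum>b\<in>B. (v \<bullet> b)\<^sup>2)"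
    using norm_orth_proj_eq_sum[OF assms(2)] by metis
  have "has_bochner_integral M (\<lambda>\<omega>. \<Sum>b\<in>B. (\<epsilon> \<omega> \<bullet> b)\<^sup>2) (\<Sum>b\<in>B. \<sigma>\<^sup>2 * (norm b)\<^sup>2)"
    by (intro has_bochner_integral_sum assms(1))
  then show ?thesis
    using B by (simp add: n)
qed

text \<open>In each block the error is shrunken noise minus shrinkage bias. Pythagoras separates the
  blocks, and inside a block the product of noise and bias has mean zero.\<close>

lemma (in prob_space) risk_eq_risk_cumulative:
  fixes \<epsilon> :: "'a \<Rightarrow> real ^ 'n"
  assumes indep: "indep_vars (\<lambda>_. borel) (\<lambda>i \<omega>. \<epsilon> \<omega> $ i) UNIV"
    and normal: "\<And>i. distributed M lborel (\<lambda>\<omega>. \<epsilon> \<omega> $ i) (normal_density 0 \<sigma>)"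
    and "\<sigma> > 0"
    and rank: "full_column_rank x p"
    and y: "\<And>\<omega>. y \<omega> = \<mu> + \<epsilon> \<omega>"
    and K: "K \<subseteq> {1..p}"
  shows "risk M y x K \<mu> w = risk_cumulative \<sigma> x K \<mu> (cumulative (card K) w)"
proof -
  have fin: "finite K" and K0: "0 \<notin> K"
    using K finite_subset by auto
  note noise = white_noise_inner[OF indep normal \<open>\<sigma> > 0\<close>]
  \<comment> \<open>Extending the cumulative weights by 0 at \<open>card K + 1\<close> gives the
    residual block, which the estimator misses entirely, the same form as the others.\<close>
  define h where "h m = (if m \<le> card K then cumulative (card K) w m else 0)" for m
  have err: "averaged x K w (y \<omega>) - \<mu>
      = (\<Sum>m=1..card K + 1. block x K m (h m *\<^sub>R \<epsilon> \<omega> - (1 - h m) *\<^sub>R \<mu>))" for \<omega>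
  proof -
    \<comment> \<open>The subtracted \<mu> is written as the sum of all its blocks, the residual one
      included.\<close>
    have "averaged x K w (y \<omega>) - \<mu> = (\<Sum>m=1..card K + 1. h m *\<^sub>R block x K m (y \<omega>))
        - (\<Sum>m=1..card K + 1. block x K m \<mu>)"
      unfolding sum_blocks by (simp add: averaged_eq_sum_blocks h_def)
    also have "\<dots> = (\<Sum>m=1..card K + 1. h m *\<^sub>R block x K m (y \<omega>) - block x K m \<mu>)"
      by (simp only: sum_subtractf)
    also have "\<dots> = (\<Sum>m=1..card K + 1. block x K m (h m *\<^sub>R \<epsilon> \<omega> - (1 - h m) *\<^sub>R \<mu>))"
    proof (intro sum.cong refl)
      fix m assume "m \<in> {1..card K + 1}"
      then interpret linear "block x K m"
        by (intro linear_block) auto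
      show "h m *\<^sub>R block x K m (y \<omega>) - block x K m \<mu>
          = block x K m (h m *\<^sub>R \<epsilon> \<omega> - (1 - h m) *\<^sub>R \<mu>)"
        by (simp add: y add diff scale algebra_simps)
    qed
    finally show ?thesis .
  qed
  have res: "h (card K + 1) = 0"
    by (simp add: h_def)
  have block_err: "has_bochner_integral M (\<lambda>\<omega>. (norm (block x K m (h m *\<^sub>R \<epsilon> \<omega> - (1 - h m) *\<^sub>R \<mu>)))\<^sup>2)
      ((norm (block x K m \<mu>))\<^sup>2 * (1 - h m)\<^sup>2 + block_var \<sigma> K m * (h m)\<^sup>2)"
    if m: "m \<in> {1..card K}" for m
  proof -
    interpret linear "block x K m"
      using m by (intro linear_block) auto
    define S T where "S = model_space x K m" and "T = model_space x K (m - 1)"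
    note ST = S_def T_def
    have sub: "subspace S" "subspace T" and nested: "T \<subseteq> S"
      unfolding ST by (rule subspace_model_space)+ (rule model_space_mono[OF fin K0], simp)
    have dims: "dim S = size_of K m" "dim T = size_of K (m - 1)"
      using m unfolding ST by (auto intro!: dim_model_space[OF rank K])
    have D: "block x K m v = orth_proj S v - orth_proj T v" for v
      using m unfolding ST by (intro block_eq_orth_proj) auto
    have var: "has_bochner_integral M (\<lambda>\<omega>. (norm (block x K m (\<epsilon> \<omega>)))\<^sup>2) (block_var \<sigma> K m)"
      using has_bochner_integral_diff[OF white_noise_orth_proj[OF noise(2) sub(1)]
          white_noise_orth_proj[OF noise(2) sub(2)]]
      by (simp add: D norm_orth_proj_diff[OF sub(2,1) nested] dims block_var_def left_diff_distrib)
    \<comment> \<open>This moves the block operator off the noise, leaving the inner product of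
      \<epsilon> with a fixed vector, whose mean is zero. It holds because \<open>v\<close> minus
      its own block is a sum of blocks orthogonal to block \<open>m\<close>.\<close>
    have cross: "block x K m v \<bullet> block x K m \<mu> = v \<bullet> block x K m \<mu>" for v
    proof -
      have "v - block x K m v = (\<Sum>j\<in>{1..card K + 1} - {m}. block x K j v)"
        using m sum.remove[of "{1..card K + 1}" m "\<lambda>j. block x K j v"]
          sum_blocks[where x = x and K = K and v = v]
        by (simp add: algebra_simps)
      moreover have "block x K j v \<bullet> block x K m \<mu> = 0" if "j \<in> {1..card K + 1} - {m}" for j
        using m that block_orthogonal[OF fin K0, of j m x v \<mu>] by (simp add: orthogonal_def)
      ultimately have "(v - block x K m v) \<bullet> block x K m \<mu> = 0"
        by (simp add: inner_sum_left)
      then show ?thesis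
        by (simp add: inner_diff_left)
    qed
    have "has_bochner_integral M (\<lambda>\<omega>. (h m)\<^sup>2 * (norm (block x K m (\<epsilon> \<omega>)))\<^sup>2
          - 2 * h m * (1 - h m) * (\<epsilon> \<omega> \<bullet> block x K m \<mu>) + (1 - h m)\<^sup>2 * (norm (block x K m \<mu>))\<^sup>2)
        ((h m)\<^sup>2 * block_var \<sigma> K m - 2 * h m * (1 - h m) * 0 + (1 - h m)\<^sup>2 * (norm (block x K m \<mu>))\<^sup>2)"
      by (intro has_bochner_integral_add has_bochner_integral_diff has_bochner_integral_mult_right var noise(1))
        (simp_all add: has_bochner_integral_iff prob_space)
    moreover have "(h m)\<^sup>2 * (norm (block x K m (\<epsilon> \<omega>)))\<^sup>2
          - 2 * h m * (1 - h m) * (\<epsilon> \<omega> \<bullet> block x K m \<mu>) + (1 - h m)\<^sup>2 * (norm (block x K m \<mu>))\<^sup>2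
        = (norm (block x K m (h m *\<^sub>R \<epsilon> \<omega> - (1 - h m) *\<^sub>R \<mu>)))\<^sup>2" for \<omega>
      unfolding diff scale power2_norm_eq_inner
      using cross[of "\<epsilon> \<omega>"]
      by (simp add: inner_commute power2_eq_square algebra_simps)
    ultimately show ?thesis
      by (simp add: mult.commute add.commute)
  qed
  \<comment> \<open>With weight 0 the residual error is the block of -\<mu>, deterministic;
    linearity takes the sign out, and the norm drops it.\<close>
  interpret res: linear "block x K (card K + 1)"
    by (intro linear_block) auto
  have "has_bochner_integral M
      (\<lambda>\<omega>. (\<Sum>m=1..card K. (norm (block x K m (h m *\<^sub>R \<epsilon> \<omega> - (1 - h m) *\<^sub>R \<mu>)))\<^sup>2)
        + (norm (block x K (card K + 1) \<mu>))\<^sup>2)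
      ((\<Sum>m=1..card K. (norm (block x K m \<mu>))\<^sup>2 * (1 - h m)\<^sup>2 + block_var \<sigma> K m * (h m)\<^sup>2)
        + (norm (block x K (card K + 1) \<mu>))\<^sup>2)"
    by (intro has_bochner_integral_add has_bochner_integral_sum block_err)
      (simp_all add: has_bochner_integral_iff prob_space)
  also have "(\<lambda>\<omega>. (\<Sum>m=1..card K. (norm (block x K m (h m *\<^sub>R \<epsilon> \<omega> - (1 - h m) *\<^sub>R \<mu>)))\<^sup>2)
        + (norm (block x K (card K + 1) \<mu>))\<^sup>2) = (\<lambda>\<omega>. (norm (averaged x K w (y \<omega>) - \<mu>))\<^sup>2)"
    unfolding err norm_sum_blocks[OF fin K0] using res by (simp add: res.neg[simplified])
  finally have "risk M y x K \<mu> w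
      = (\<Sum>m=1..card K. (norm (block x K m \<mu>))\<^sup>2 * (1 - h m)\<^sup>2 + block_var \<sigma> K m * (h m)\<^sup>2)
        + (norm (block x K (card K + 1) \<mu>))\<^sup>2"
    unfolding risk_def by (rule has_bochner_integral_integral_eq)
  also have "\<dots> = risk_cumulative \<sigma> x K \<mu> (cumulative (card K) w)"
    by (simp add: risk_cumulative_def h_def)
  finally show ?thesis .
qed


section \<open>Cumulative weights\<close>

text \<open>The case split encodes the convention that the entry after the last is 0: as an
  extensional function, \<open>cumulative M w\<close> has the value \<open>undefined\<close> at
  \<open>Suc M\<close>.\<close>

lemma cumulative_Suc:
  assumes "m \<in> {1..M}"
  shows "cumulative M w m = w m + (if m = M then 0 else cumulative M w (Suc m))"
  using assms by (auto simp: cumulative_def sum.atLeast_Suc_atMost)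

text \<open>Weights are successive differences of cumulative weights. Nonnegative weights thus
  correspond to monotonicity together with a nonnegative last entry, and total weight 1 to the first
  entry being 1.\<close>

lemma weight_simplex_iff_cumulative:
  assumes "w \<in> vectors M" "1 \<le> M"
  shows "w \<in> weight_simplex M \<longleftrightarrow> cumulative M w \<in> monotone_vectors M"
proof
  assume w: "w \<in> weight_simplex M"
  then have nn: "0 \<le> w m" if "m \<in> {1..M}" for m
    using that by (auto simp: weight_simplex_def PiE_iff)
  have "cumulative M w 1 = 1" "0 \<le> cumulative M w M"
    using w nn[of M] assms(2) by (auto simp: cumulative_def weight_simplex_def)
  moreover have "cumulative M w (Suc m) \<le> cumulative M w m" if "m \<in> {1..<M}" for m
    using that nn[of m] cumulative_Suc[of m M w] by auto
  ultimately show "cumulative M w \<in> monotone_vectors M"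
    by (auto simp: monotone_vectors_def vectors_def cumulative_def)
next
  assume g: "cumulative M w \<in> monotone_vectors M"
  have nn: "0 \<le> w m" if "m \<in> {1..M}" for m
  proof (cases "m = M")
    case True
    then show ?thesis
      using that g cumulative_Suc[OF that, of w] by (simp add: monotone_vectors_def)
  next
    case False
    then have "cumulative M w (Suc m) \<le> cumulative M w m"
      using that g by (simp add: monotone_vectors_def)
    then show ?thesis
      using False cumulative_Suc[OF that, of w] by simp
  qed
  have s: "(\<Sum>m=1..M. w m) = 1"
    using g assms(2) by (auto simp: monotone_vectors_def cumulative_def)
  have "w m \<le> 1" if "m \<in> {1..M}" for m
    using member_le_sum[OF that, of w] nn s by auto
  with nn s show "w \<in> weight_simplex M"
    using assms(1) by (auto simp: weight_simplex_def vectors_def PiE_iff)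
qed

lemma bij_betw_cumulative: "bij_betw (cumulative M) (vectors M) (vectors M)"
proof (rule bij_betw_byWitness[where f' = "\<lambda>\<gamma>. \<lambda>m\<in>{1..M}. \<gamma> m - (if m = M then 0 else \<gamma> (Suc m))"])
  show "\<forall>w\<in>vectors M. (\<lambda>m\<in>{1..M}. cumulative M w m - (if m = M then 0 else cumulative M w (Suc m))) = w"
    by (auto simp: vectors_def PiE_iff extensional_def cumulative_Suc fun_eq_iff)
  \<comment> \<open>The differences telescope; the induction runs downwards from \<open>M\<close>,
    where the boundary term is 0.\<close>
  have "(\<Sum>j=m..M. \<gamma> j - (if j = M then 0 else \<gamma> (Suc j))) = \<gamma> m" if "m \<le> M" for \<gamma> :: "nat \<Rightarrow> real" and m
    using that
  proof (induction rule: inc_induct)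
    case (step n)
    then show ?case
      by (simp add: sum.atLeast_Suc_atMost)
  qed simp
  then show "\<forall>\<gamma>\<in>vectors M. cumulative M (\<lambda>m\<in>{1..M}. \<gamma> m - (if m = M then 0 else \<gamma> (Suc m))) = \<gamma>"
    by (auto simp: vectors_def PiE_iff extensional_def cumulative_def fun_eq_iff)
qed (auto simp: vectors_def cumulative_def)


section \<open>Minimisers\<close>

text \<open>A closed subset of a product of compact sets is compact in the product topology.
  Coordinates outside \<open>{1..M}\<close> range over the singleton of \<open>undefined\<close>,
  which makes the extensional encoding compatible with Tychonoff.\<close>

lemma compact_monotone_vectors: "compact (monotone_vectors M)"
proof (cases "1 \<le> M")
  case True
  let ?B = "\<lambda>m. if m \<in> {1..M} then {0..1} else {undefined :: real}"
  let ?C = "{\<gamma> :: nat \<Rightarrow> real. \<gamma> 1 = 1} \<inter> (\<Inter>m\<in>{1..<M}. {\<gamma>. \<gamma> (Suc m) \<le> \<gamma> m}) \<inter> {\<gamma>. 0 \<le> \<gamma> M}"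
  have "compact (Pi\<^sub>E UNIV ?B)"
    using compactin_PiE[of "\<lambda>_::nat. euclidean :: real topology" UNIV ?B]
    by (simp add: euclidean_product_topology)
  moreover have "closed ?C"
    by (intro closed_Int closed_INT ballI closed_Collect_eq closed_Collect_le
        continuous_on_product_coordinates continuous_on_const)
  moreover have "monotone_vectors M = Pi\<^sub>E UNIV ?B \<inter> ?C"
  proof (intro equalityI subsetI)
    fix \<gamma> assume \<gamma>: "\<gamma> \<in> monotone_vectors M"
    \<comment> \<open>Chaining the one-step inequalities places every entry between the last, which
      is at least 0, and the first, which is 1.\<close>
    have le: "\<gamma> j \<le> \<gamma> i" if "i \<le> j" "1 \<le> i" "j \<le> M" for i j
      using that
    proof (induction rule: dec_induct)
      case (step n)
      then have "\<gamma> (Suc n) \<le> \<gamma> n"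
        using \<gamma> by (simp add: monotone_vectors_def)
      with step show ?case
        by simp
    qed simp
    have "\<gamma> m \<in> {0..1}" if "m \<in> {1..M}" for m
      using \<gamma> that le[of 1 m] le[of m M] by (auto simp: monotone_vectors_def)
    then show "\<gamma> \<in> Pi\<^sub>E UNIV ?B \<inter> ?C"
      using \<gamma> by (simp add: monotone_vectors_def vectors_def PiE_iff extensional_def)
  next
    fix \<gamma> assume "\<gamma> \<in> Pi\<^sub>E UNIV ?B \<inter> ?C"
    then show "\<gamma> \<in> monotone_vectors M"
      by (auto simp: monotone_vectors_def vectors_def PiE_iff extensional_def split: if_splits)
  qed
  ultimately show ?thesis
    by (simp add: compact_Int_closed)
next
  case False
  \<comment> \<open>For \<open>M = 0\<close> the only extensional function is constantly
    \<open>undefined\<close>.\<close>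
  have "monotone_vectors M \<subseteq> {\<lambda>_. undefined}"
    using False by (auto simp: monotone_vectors_def vectors_def)
  then show ?thesis
    by (meson finite.intros finite_imp_compact finite_subset)
qed

lemma monotone_vectors_midpoint:
  assumes "\<gamma> \<in> monotone_vectors M" "\<gamma>' \<in> monotone_vectors M" "1 \<le> M"
  shows "(\<lambda>m\<in>{1..M}. (\<gamma> m + \<gamma>' m) / 2) \<in> monotone_vectors M"
proof -
  have "(\<gamma> (Suc m) + \<gamma>' (Suc m)) / 2 \<le> (\<gamma> m + \<gamma>' m) / 2" if "m \<in> {1..<M}" for m
    using that assms(1,2) by (intro divide_right_mono add_mono) (auto simp: monotone_vectors_def)
  then show ?thesis
    using assms by (auto simp: monotone_vectors_def vectors_def)
qed

lemma ex1_argmin_monotone_vectors: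
  fixes c :: real
  assumes "1 \<le> M" and a: "\<And>m. m \<in> {1..M} \<Longrightarrow> 0 \<le> a m" and b: "\<And>m. m \<in> {1..M} \<Longrightarrow> 0 < b m"
  defines "R \<equiv> \<lambda>\<gamma>. (\<Sum>m=1..M. a m * (1 - \<gamma> m)\<^sup>2 + b m * (\<gamma> m)\<^sup>2) + c"
  shows "\<exists>!\<gamma>. is_arg_min R (\<lambda>\<gamma>. \<gamma> \<in> monotone_vectors M) \<gamma>"
proof (rule ex_ex1I)
  \<comment> \<open>Compactness yields a minimiser only on a nonempty set; the constant vector 1 is
    a witness.\<close>
  have "(\<lambda>m\<in>{1..M}. 1) \<in> monotone_vectors M"
    using assms(1) by (auto simp: monotone_vectors_def vectors_def)
  moreover have "continuous_on (monotone_vectors M) R"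
    unfolding R_def
    by (intro continuous_intros continuous_on_subset[OF continuous_on_product_coordinates subset_UNIV])
  ultimately show "\<exists>\<gamma>. is_arg_min R (\<lambda>\<gamma>. \<gamma> \<in> monotone_vectors M) \<gamma>"
    using continuous_attains_inf[OF compact_monotone_vectors, of M R]
    unfolding is_arg_min_linorder by blast
next
  fix \<gamma> \<gamma>' assume min: "is_arg_min R (\<lambda>\<gamma>. \<gamma> \<in> monotone_vectors M) \<gamma>"
    "is_arg_min R (\<lambda>\<gamma>. \<gamma> \<in> monotone_vectors M) \<gamma>'"
  let ?mid = "\<lambda>m\<in>{1..M}. (\<gamma> m + \<gamma>' m) / 2"
  have mem: "\<gamma> \<in> monotone_vectors M" "\<gamma>' \<in> monotone_vectors M"
    using min by (auto simp: is_arg_min_linorder)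
  then have "R \<gamma> \<le> R ?mid" "R \<gamma>' \<le> R ?mid"
    using min monotone_vectors_midpoint[OF mem assms(1)] by (auto simp: is_arg_min_linorder)
  \<comment> \<open>The parallelogram identity in each coordinate. Both minimisers are at most
    \<open>R ?mid\<close>, so the nonnegative last sum must vanish, and \<open>b m > 0\<close> then
    forces equal coordinates even where \<open>a m = 0\<close>.\<close>
  moreover have "R \<gamma> + R \<gamma>' = 2 * R ?mid + (\<Sum>m=1..M. (a m + b m) * (\<gamma> m - \<gamma>' m)\<^sup>2) / 2"
  proof -
    have "(\<Sum>m=1..M. a m * (1 - \<gamma> m)\<^sup>2 + b m * (\<gamma> m)\<^sup>2) + (\<Sum>m=1..M. a m * (1 - \<gamma>' m)\<^sup>2 + b m * (\<gamma>' m)\<^sup>2)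
      = (\<Sum>m=1..M. 2 * (a m * (1 - ?mid m)\<^sup>2 + b m * (?mid m)\<^sup>2) + (a m + b m) * (\<gamma> m - \<gamma>' m)\<^sup>2 / 2)"
      unfolding sum.distrib[symmetric]
      by (intro sum.cong) (auto simp: power2_eq_square field_simps)
    then show ?thesis
      by (simp add: R_def sum.distrib sum_distrib_left sum_divide_distrib)
  qed
  moreover have nn: "0 \<le> (a m + b m) * (\<gamma> m - \<gamma>' m)\<^sup>2" if "m \<in> {1..M}" for m
    using a[OF that] b[OF that] by simp
  ultimately have "(\<Sum>m=1..M. (a m + b m) * (\<gamma> m - \<gamma>' m)\<^sup>2) = 0"
    using sum_nonneg[of "{1..M}" "\<lambda>m. (a m + b m) * (\<gamma> m - \<gamma>' m)\<^sup>2"] by force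
  then have "(a m + b m) * (\<gamma> m - \<gamma>' m)\<^sup>2 = 0" if "m \<in> {1..M}" for m
    using sum_nonneg_eq_0_iff[of "{1..M}" "\<lambda>m. (a m + b m) * (\<gamma> m - \<gamma>' m)\<^sup>2"] nn that by auto
  then have "\<gamma> m = \<gamma>' m" if "m \<in> {1..M}" for m
    using a[OF that] b[OF that] that by fastforce
  moreover have "\<gamma> \<in> vectors M" "\<gamma>' \<in> vectors M"
    using mem by (simp_all add: monotone_vectors_def)
  ultimately show "\<gamma> = \<gamma>'"
    unfolding vectors_def by (intro PiE_ext)
qed

section \<open>Strict convexity of the risk and transfer of minimisers\<close>

lemma block_var_pos:
  assumes "finite K" "0 \<notin> K" "\<sigma> > 0" "m \<in> {1..card K}"
  shows "0 < block_var \<sigma> K m"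
  using assms size_of_less[OF assms(1,2), of "m - 1" m] by (simp add: block_var_def)

lemma is_arg_min_bij_betw:
  fixes f :: "'a \<Rightarrow> 'c::linorder"
  assumes "bij_betw c A B" "\<And>a. a \<in> A \<Longrightarrow> f a = g (c a)" "a \<in> A"
  shows "is_arg_min f (\<lambda>a. a \<in> A) a \<longleftrightarrow> is_arg_min g (\<lambda>b. b \<in> B) (c a)"
  using assms by (auto simp: is_arg_min_linorder bij_betw_def)

theorem mainTheorem4:
  fixes \<Omega> :: "'w measure"
    and \<epsilon> y :: "'w \<Rightarrow> real ^ 'n"
    and x :: "nat \<Rightarrow> real ^ 'n"
    and \<mu> :: "real ^ 'n"
    and \<beta> :: "nat \<Rightarrow> real"
    and \<sigma> :: real
    and p M :: nat
    and K :: "nat set"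
  assumes "prob_space \<Omega>"
    and "prob_space.indep_vars \<Omega> (\<lambda>_. borel) (\<lambda>i \<omega>. \<epsilon> \<omega> $ i) UNIV"
    and "\<And>i. distributed \<Omega> lborel (\<lambda>\<omega>. \<epsilon> \<omega> $ i) (normal_density 0 \<sigma>)"
    and "\<sigma> > 0"
    and "p \<le> CARD('n)"
    and "full_column_rank x p"
    and "\<mu> = (\<Sum>j=1..p. \<beta> j *\<^sub>R x j)"
    and "\<And>\<omega>. y \<omega> = \<mu> + \<epsilon> \<omega>"
    and "K \<subseteq> {1..p}"
    and "K \<noteq> {}"
    and "M = card K"
  shows
    "(\<forall>w\<in>vectors M.
        (\<forall>\<omega>\<in>space \<Omega>. averaged x K w (y \<omega>) =
            (\<Sum>m=1..M. cumulative M w m *\<^sub>R block x K m (y \<omega>))) \<and>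
        risk \<Omega> y x K \<mu> w = risk_cumulative \<sigma> x K \<mu> (cumulative M w) \<and>
        (w \<in> weight_simplex M \<longleftrightarrow> cumulative M w \<in> monotone_vectors M)) \<and>
     (\<exists>!w. is_arg_min (risk \<Omega> y x K \<mu>) (\<lambda>w. w \<in> weight_simplex M) w) \<and>
     (\<exists>!\<gamma>. is_arg_min (risk_cumulative \<sigma> x K \<mu>) (\<lambda>\<gamma>. \<gamma> \<in> monotone_vectors M) \<gamma>) \<and>
     (\<forall>w \<gamma>.
        is_arg_min (risk \<Omega> y x K \<mu>) (\<lambda>w. w \<in> weight_simplex M) w \<longrightarrow>
        is_arg_min (risk_cumulative \<sigma> x K \<mu>) (\<lambda>\<gamma>. \<gamma> \<in> monotone_vectors M) \<gamma> \<longrightarrow>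
        (\<forall>m\<in>{1..M}. w m = \<gamma> m - (if m = M then 0 else \<gamma> (m + 1))))"
proof -
  interpret prob_space \<Omega>
    by fact
  have fin: "finite K" and K0: "0 \<notin> K"
    using \<open>K \<subseteq> {1..p}\<close> finite_subset by auto
  have M1: "1 \<le> M"
    using fin \<open>K \<noteq> {}\<close> \<open>M = card K\<close> by (simp add: Suc_le_eq card_gt_0_iff)
  let ?R = "risk \<Omega> y x K \<mu>" and ?Rc = "risk_cumulative \<sigma> x K \<mu>"
  let ?W = "weight_simplex M" and ?G = "monotone_vectors M"
  have risk: "?R w = ?Rc (cumulative M w)" for w
    unfolding \<open>M = card K\<close> by (rule risk_eq_risk_cumulative) fact+
  have simplex: "w \<in> ?W \<longleftrightarrow> cumulative M w \<in> ?G" if "w \<in> vectors M" for w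
    using weight_simplex_iff_cumulative[OF that M1] .
  have sub: "?W \<subseteq> vectors M" "?G \<subseteq> vectors M"
    by (auto simp: weight_simplex_def monotone_vectors_def vectors_def PiE_iff extensional_def)
  \<comment> \<open>The bijection on all vectors restricts: a monotone vector has a preimage among
    the vectors, and the equivalence \<open>simplex\<close> puts it in the simplex.\<close>
  have bij: "bij_betw (cumulative M) ?W ?G"
  proof (rule bij_betw_subset[OF bij_betw_cumulative sub(1)])
    show "cumulative M ` ?W = ?G"
    proof
      show "cumulative M ` ?W \<subseteq> ?G"
        using simplex sub(1) by blast
      show "?G \<subseteq> cumulative M ` ?W"
      proof
        fix \<gamma> assume \<gamma>: "\<gamma> \<in> ?G"
        then obtain w where w: "w \<in> vectors M" "\<gamma> = cumulative M w"
          using sub(2) bij_betw_imp_surj_on[OF bij_betw_cumulative[of M]] by blast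
        then show "\<gamma> \<in> cumulative M ` ?W"
          using \<gamma> simplex by simp
      qed
    qed
  qed
  have argmin: "is_arg_min ?R (\<lambda>w. w \<in> ?W) w \<longleftrightarrow> is_arg_min ?Rc (\<lambda>\<gamma>. \<gamma> \<in> ?G) (cumulative M w)"
    if "w \<in> ?W" for w
    using bij that by (intro is_arg_min_bij_betw risk)
  have mem: "is_arg_min ?R (\<lambda>w. w \<in> ?W) w \<Longrightarrow> w \<in> ?W"
    "is_arg_min ?Rc (\<lambda>\<gamma>. \<gamma> \<in> ?G) \<gamma> \<Longrightarrow> \<gamma> \<in> ?G" for w \<gamma>
    by (auto simp: is_arg_min_def)
  \<comment> \<open>Here \<open>a m\<close> is the squared norm of a block of \<mu>,
    \<open>b m\<close> the block variance, and \<open>c\<close> the squared norm of the residual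
    block.\<close>
  have ex1: "\<exists>!\<gamma>. is_arg_min ?Rc (\<lambda>\<gamma>. \<gamma> \<in> ?G) \<gamma>"
    unfolding risk_cumulative_def \<open>M = card K\<close>[symmetric]
    using block_var_pos[OF fin K0 \<open>\<sigma> > 0\<close>] \<open>M = card K\<close>
    by (intro ex1_argmin_monotone_vectors[OF M1]) auto
  then obtain \<gamma> where \<gamma>: "is_arg_min ?Rc (\<lambda>\<gamma>. \<gamma> \<in> ?G) \<gamma>"
    by blast
  then obtain w where w: "w \<in> ?W" "cumulative M w = \<gamma>"
    using bij mem(2) by (metis bij_betw_imp_surj_on imageE)
  \<comment> \<open>The cumulative vector of an optimal weight vector is itself a monotone oracle,
    and the oracle is unique.\<close>
  have related: "\<gamma>' = cumulative M w'"
    if "is_arg_min ?R (\<lambda>w. w \<in> ?W) w'" "is_arg_min ?Rc (\<lambda>\<gamma>. \<gamma> \<in> ?G) \<gamma>'" for w' \<gamma>'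
    using that argmin mem(1) ex1 by blast
  have ex1_w: "\<exists>!w. is_arg_min ?R (\<lambda>w. w \<in> ?W) w"
  proof (rule ex1I[of _ w])
    show "is_arg_min ?R (\<lambda>w. w \<in> ?W) w"
      using argmin w \<gamma> by simp
    show "w' = w" if "is_arg_min ?R (\<lambda>w. w \<in> ?W) w'" for w'
      using related[OF that \<gamma>] w mem(1)[OF that] bij by (metis bij_betw_imp_inj_on inj_onD)
  qed
  show ?thesis
  proof (intro conjI ballI allI impI)
    show "averaged x K w (y \<omega>) = (\<Sum>m=1..M. cumulative M w m *\<^sub>R block x K m (y \<omega>))" for w \<omega>
      unfolding \<open>M = card K\<close> by (rule averaged_eq_sum_blocks)
  next
    fix w \<gamma> m
    assume "is_arg_min ?R (\<lambda>w. w \<in> ?W) w" "is_arg_min ?Rc (\<lambda>\<gamma>. \<gamma> \<in> ?G) \<gamma>" "m \<in> {1..M}"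
    then show "w m = \<gamma> m - (if m = M then 0 else \<gamma> (m + 1))"
      using related cumulative_Suc[of m M w] by simp
  qed (rule risk simplex ex1 ex1_w | assumption)+
qed

end
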